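(* Let $\delta=(\delta_1,\ldots,\delta_\ell)$ be a composition and let $G(\delta)$ be the corresponding gate. The map $\phi$ sending a restricted ideal $\lfloor d\rfloor$ of $G(\delta)$ to the subset $\lceil e\rceil$, where $e$ is obtained from $d=(d_1,\ldots,d_\ell)$ by steps (P1) and (P2) below, is a well-defined bijection from the set of restricted ideals of $G(\delta)$ to the set of restricted filters of $G(\delta)$, and it preserves cardinality.
   Context: For a composition $\beta$ with $s$ parts, the fence $F(\beta)$ is obtained from chains $S_1,\dots,S_s$ with $\#S_i=\beta_i+1$ by identifying the maximal elements of $S_i,S_{i+1}$ for $i$ odd and the minimal elements for $i$ even. The gate is $G(\delta)=F(\delta_1,1,\delta_2,1,\ldots,1,\delta_\ell)^*$ (the order dual). Concretely, $G(\delta)$ is the disjoint union of chains $D_1,\ldots,D_\ell$ (its descending segments, left to right), where $D_i$ has $\delta_i+1$ elements, with the additional cover relations that the minimum of $D_i$ is covered by the maximum of $D_{i+1}$ for $1\le i<\ell$. For a sequence $d=(d_1,\ldots,d_\ell)$, $\lfloor d\rfloor$ denotes the subset of $G(\delta)$ consisting of the $d_i$ smallest elements of $D_i$ for each $i$, and $\lceil e\rceil$ the subset consisting of the $e_i$ largest elements of $D_i$; every lower order ideal has the form $\lfloor d\rfloor$ and every upper order ideal (filter) the form $\lceil e\rceil$. A lower order ideal $\lfloor d\rfloor$ is restricted if $d_1\le\delta_1$ and $d_\ell\neq1$. A filter $\lceil e\rceil$ is restricted if $e_1\neq1$ and $e_\ell\le\delta_\ell$. For a sequence of nonnegative integers,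 a factor is a run of consecutive entries; a block is a maximal factor of positive entries; the factor of trailing ones $T$ of a block $B$ is the maximal (possibly empty) final segment of $B$ consisting only of ones, and $B'$ denotes $B$ with $T$ removed (so $B=B'T$). The map on sequences is: (P1) for each block whose factor of trailing ones $T$ is nonempty, exchange $T$ with the entry $0$ immediately to its right (i.e. the factor $T,0$ becomes $0,T$); (P2) for each block $B$ with $\#B'\ge2$, decrease the last entry of $B'$ by $1$ and increase the first entry of $B'$ by $1$. (This map is applied only to sequences in which each nonempty $T$ is immediately followed by a $0$.) Example: $6,1,1,1,0,4,5,1,1,0,0,3,1,2\mapsto 6,0,1,1,1,5,4,0,1,1,0,4,1,1$. *)

theory Defs
  imports Main
begin

definition composition :: "nat list \<Rightarrow> bool" where
  "composition \<delta> \<longleftrightarrow> \<delta> \<noteq> [] \<and> (\<forall>x\<in>set \<delta>. 0 < x)"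

(* All indices start at 0.  The pair (i, j) is the element of rank j (j = 0 is the minimum)
   of the descending segment with index i, which has \<delta> ! i + 1 elements. *)

definition gate_chain :: "nat list \<Rightarrow> nat \<Rightarrow> (nat \<times> nat) set" where
  "gate_chain \<delta> i = {(i, j) | j. j \<le> \<delta> ! i}"

definition gate :: "nat list \<Rightarrow> (nat \<times> nat) set" where
  "gate \<delta> = (\<Union>i<length \<delta>. gate_chain \<delta> i)"

definition gate_covers :: "nat list \<Rightarrow> ((nat \<times> nat) \<times> (nat \<times> nat)) set" where
  "gate_covers \<delta> =
     {((i, j), (i, Suc j)) | i j. i < length \<delta> \<and> Suc j \<le> \<delta> ! i} \<union>
     {((i, 0), (Suc i, \<delta> ! Suc i)) | i. Suc i < length \<delta>}"

definition gate_order :: "nat list \<Rightarrow> ((nat \<times> nat) \<times> (nat \<times> nat)) set" where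
  "gate_order \<delta> = (gate_covers \<delta>)\<^sup>* \<inter> gate \<delta> \<times> gate \<delta>"

lemma partial_order_on_gate: "partial_order_on (gate \<delta>) (gate_order \<delta>)"
proof -
  have lex: "fst x < fst y \<or> (fst x = fst y \<and> snd x \<le> snd y)"
    if "(x, y) \<in> (gate_covers \<delta>)\<^sup>*" for x y
    using that by (induction rule: rtrancl_induct) (auto simp: gate_covers_def)
  have "antisym (gate_order \<delta>)"
    by (rule antisymI) (auto simp: gate_order_def dest!: lex)
  moreover have "refl_on (gate \<delta>) (gate_order \<delta>)"
    by (auto simp: refl_on_def gate_order_def)
  moreover have "trans (gate_order \<delta>)"
    by (rule transI) (auto simp: gate_order_def)
  ultimately show ?thesis
    by (auto simp: partial_order_on_def preorder_on_def gate_order_def)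
qed

definition gate_ideal :: "nat list \<Rightarrow> (nat \<times> nat) set \<Rightarrow> bool" where
  "gate_ideal \<delta> I \<longleftrightarrow>
     I \<subseteq> gate \<delta> \<and> (\<forall>x y. (x, y) \<in> gate_order \<delta> \<longrightarrow> y \<in> I \<longrightarrow> x \<in> I)"

definition gate_filter :: "nat list \<Rightarrow> (nat \<times> nat) set \<Rightarrow> bool" where
  "gate_filter \<delta> U \<longleftrightarrow>
     U \<subseteq> gate \<delta> \<and> (\<forall>x y. (x, y) \<in> gate_order \<delta> \<longrightarrow> x \<in> U \<longrightarrow> y \<in> U)"

(* The sequences d for which "the d_i smallest (largest) elements of D_i" makes sense for every i. *)

definition gate_seqs :: "nat list \<Rightarrow> nat list set" where
  "gate_seqs \<delta> = {d. length d = length \<delta> \<and> (\<forall>i<length \<delta>. d ! i \<le> \<delta> ! i + 1)}"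

definition lower_set :: "nat list \<Rightarrow> nat list \<Rightarrow> (nat \<times> nat) set" where
  "lower_set \<delta> d = {(i, j) \<in> gate \<delta>. j < d ! i}"

definition upper_set :: "nat list \<Rightarrow> nat list \<Rightarrow> (nat \<times> nat) set" where
  "upper_set \<delta> e = {(i, j) \<in> gate \<delta>. \<delta> ! i < j + e ! i}"

definition restricted_ideals :: "nat list \<Rightarrow> (nat \<times> nat) set set" where
  "restricted_ideals \<delta> =
     {lower_set \<delta> d | d. d \<in> gate_seqs \<delta> \<and> gate_ideal \<delta> (lower_set \<delta> d) \<and>
        hd d \<le> hd \<delta> \<and> last d \<noteq> 1}"

definition restricted_filters :: "nat list \<Rightarrow> (nat \<times> nat) set set" where
  "restricted_filters \<delta> =
     {upper_set \<delta> e | e. e \<in> gate_seqs \<delta> \<and> gate_filter \<delta> (upper_set \<delta> e) \<and>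
        hd e \<noteq> 1 \<and> last e \<le> last \<delta>}"

(* B is a block of the sequence U @ B @ V. *)

definition is_block :: "nat list \<Rightarrow> nat list \<Rightarrow> nat list \<Rightarrow> bool" where
  "is_block U B V \<longleftrightarrow>
     B \<noteq> [] \<and> (\<forall>x\<in>set B. 0 < x) \<and> (U = [] \<or> last U = 0) \<and> (V = [] \<or> hd V = 0)"

definition trailing_ones :: "nat list \<Rightarrow> nat list" where
  "trailing_ones B = takeWhile (\<lambda>x. x = 1) (rev B)"

definition without_trailing_ones :: "nat list \<Rightarrow> nat list" where
  "without_trailing_ones B = rev (dropWhile (\<lambda>x. x = 1) (rev B))"

lemma block_decomposition: "without_trailing_ones B @ trailing_ones B = B"
proof -
  have "rev (takeWhile (\<lambda>x. x = 1) (rev B)) = takeWhile (\<lambda>x. x = 1) (rev B)"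
    by (metis (mono_tags, lifting) replicate_length_same rev_replicate set_takeWhileD)
  then show ?thesis
    unfolding trailing_ones_def without_trailing_ones_def
    by (metis rev_append rev_rev_ident takeWhile_dropWhile_id)
qed

definition trailing_ones_followed_by_zero :: "nat list \<Rightarrow> bool" where
  "trailing_ones_followed_by_zero d \<longleftrightarrow>
     (\<forall>U B V. d = U @ B @ V \<and> is_block U B V \<and> trailing_ones B \<noteq> [] \<longrightarrow>
        V \<noteq> [] \<and> hd V = 0)"

definition shift_unit :: "nat list \<Rightarrow> nat list" where
  "shift_unit B' =
     (if 2 \<le> length B'
      then B'[length B' - 1 := last B' - 1, 0 := hd B' + 1]
      else B')"

(* The blocks are processed from left to right, each split as B = B' T with T its trailing ones:
   T is exchanged with the 0 to its right, and a unit is moved from the last to the first entry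
   of B'.  Both steps refer to the blocks of the original sequence.  If a nonempty T ends the
   sequence, it is left in place; such sequences are outside the domain of the map. *)

function gate_map :: "nat list \<Rightarrow> nat list" where
  "gate_map [] = []"
| "gate_map (0 # xs) = 0 # gate_map xs"
| "gate_map (Suc x # xs) =
     (let B = takeWhile (\<lambda>y. 0 < y) (Suc x # xs);
          R = dropWhile (\<lambda>y. 0 < y) (Suc x # xs);
          T = trailing_ones B;
          B' = without_trailing_ones B
      in if T \<noteq> [] \<and> R \<noteq> []
         then shift_unit B' @ [0] @ T @ gate_map (tl R)
         else shift_unit B' @ T @ gate_map R)"
  by pat_completeness auto
termination
proof (relation "measure length", goal_cases)
  case (3 x xs B R T B')
  have "length (dropWhile (\<lambda>y. 0 < y) xs) \<le> length xs"
    by (rule length_dropWhile_le)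
  with 3 show ?case by simp
next
  case (4 x xs B R T B')
  have "length (dropWhile (\<lambda>y. 0 < y) xs) \<le> length xs"
    by (rule length_dropWhile_le)
  with 4 show ?case by simp
qed auto

lemma gate_map_example:
  "gate_map [6, 1, 1, 1, 0, 4, 5, 1, 1, 0, 0, 3, 1, 2] =
     [6, 0, 1, 1, 1, 5, 4, 0, 1, 1, 0, 4, 1, 1]"
  by code_simp

definition gate_phi :: "nat list \<Rightarrow> (nat \<times> nat) set \<Rightarrow> (nat \<times> nat) set" where
  "gate_phi \<delta> I = upper_set \<delta> (gate_map (THE d. d \<in> gate_seqs \<delta> \<and> I = lower_set \<delta> d))"

end

theory Submission
  imports Defs
begin

text \<open>
  A sequence not ending in \<open>1\<close> is uniquely of the form \<open>B\<^sub>1 T\<^sub>1 0 B\<^sub>2 T\<^sub>2 0 \<dots> B\<^sub>n\<close>, where the \<open>T\<^sub>i\<close>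
  consist of ones and the \<open>B\<^sub>i\<close> are positive and do not end in \<open>1\<close> (both may be empty). The map
  turns it into \<open>C\<^sub>1 0 T\<^sub>1 C\<^sub>2 0 T\<^sub>2 \<dots> C\<^sub>n\<close>, where \<open>C\<^sub>i\<close> is \<open>B\<^sub>i\<close> after moving a unit from its last to
  its first entry. As \<open>C\<^sub>i\<close> does not start with \<open>1\<close>, the reversed image again has this form, with
  the same ones, and moving the units in the reversed \<open>C\<^sub>i\<close> restores \<open>B\<^sub>i\<close> reversed. So the map
  followed by reversal is an involution. Reversal also exchanges restricted filters of
  \<open>G(\<delta>)\<close> with restricted ideals of \<open>G(rev \<delta>)\<close>, so it suffices to see that the map sends
  restricted ideals to restricted filters; its inverse then does the converse.
\<close>

section \<open>Cutting a sequence into cores, runs of ones and zeros\<close>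

definition core :: "nat list \<Rightarrow> bool" where
  "core B \<longleftrightarrow> (\<forall>x\<in>set B. 0 < x) \<and> (B = [] \<or> last B \<noteq> 1)"

lemma trailing_ones_core:
  assumes "core B"
  shows "trailing_ones (B @ replicate k 1) = replicate k 1"
    and "without_trailing_ones (B @ replicate k 1) = B"
proof -
  have B: "takeWhile (\<lambda>x. x = 1) (rev B) = []" "dropWhile (\<lambda>x. x = 1) (rev B) = rev B"
    using assms by (cases B rule: rev_cases; simp add: core_def)+
  have "takeWhile (\<lambda>x. x = 1) (replicate k 1 @ rev B) = replicate k 1"
    "dropWhile (\<lambda>x. x = 1) (replicate k 1 @ rev B) = rev B"
    using B by (induction k) simp_all
  then show "trailing_ones (B @ replicate k 1) = replicate k 1"
    "without_trailing_ones (B @ replicate k 1) = B"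
    by (simp_all add: trailing_ones_def without_trailing_ones_def)
qed

text \<open>One formula covers the degenerate cases too. For \<open>k > 0\<close> it is the exchange
  in (P1). For \<open>k = 0\<close> and nonempty \<open>B\<close>, the branch without exchange
  leaves \<open>0 # d\<close> to the recursion, which copies the zero. If \<open>B\<close> and the
  run of ones are both empty, only this copying occurs.\<close>

lemma gate_map_first_block:
  assumes "core B"
  shows "gate_map (B @ replicate k 1 @ 0 # d) = shift_unit B @ 0 # replicate k 1 @ gate_map d"
proof (cases "B @ replicate k 1")
  case Nil
  then show ?thesis by (simp add: shift_unit_def)
next
  case (Cons y ys)
  have pos: "\<forall>x\<in>set (B @ replicate k 1). 0 < x"
    using assms by (auto simp: core_def)
  with Cons obtain x where x: "y = Suc x"
    by (metis gr0_implies_Suc list.set_intros(1))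
  have eq: "B @ replicate k 1 @ 0 # d = Suc x # ys @ 0 # d"
    using Cons x by (metis append.assoc append_Cons)
  have "takeWhile (\<lambda>y. 0 < y) (A @ 0 # d) = A \<and> dropWhile (\<lambda>y. 0 < y) (A @ 0 # d) = 0 # d"
    if "\<forall>x\<in>set A. 0 < x" for A
    using that by (induction A) auto
  from this[OF pos] have tw: "takeWhile (\<lambda>y. 0 < y) (Suc x # ys @ 0 # d) = B @ replicate k 1"
    and dw: "dropWhile (\<lambda>y. 0 < y) (Suc x # ys @ 0 # d) = 0 # d"
    unfolding append_assoc eq by (rule conjunct1, rule conjunct2)
  show ?thesis
    unfolding eq gate_map.simps(3) Let_def tw dw trailing_ones_core[OF assms]
    by (cases k) auto
qed

lemma gate_map_core:
  assumes "core B"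
  shows "gate_map B = shift_unit B"
proof (cases B)
  case Nil
  then show ?thesis by (simp add: shift_unit_def)
next
  case (Cons y ys)
  have pos: "\<forall>x\<in>set B. 0 < x"
    using assms by (auto simp: core_def)
  with Cons obtain x where eq: "B = Suc x # ys"
    by (metis gr0_implies_Suc list.set_intros(1))
  have tw: "takeWhile (\<lambda>y. 0 < y) (Suc x # ys) = B" "dropWhile (\<lambda>y. 0 < y) (Suc x # ys) = []"
    using pos eq by auto
  show ?thesis
    using trailing_ones_core[OF assms, of 0]
    by (subst eq) (simp only: gate_map.simps(3) Let_def tw, simp)
qed

lemma positive_decomposition:
  assumes "\<forall>x\<in>set B. 0 < x"
  obtains B' k where "core B'" "B = B' @ replicate k 1"
proof -
  have "\<exists>B' k. core B' \<and> B = B' @ replicate k 1"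
    using assms
  proof (induction B rule: rev_induct)
    case Nil
    have "core []" by (simp add: core_def)
    then show ?case by auto
  next
    case (snoc x B)
    show ?case
    proof (cases "x = 1")
      case True
      from snoc obtain B' k where "core B'" "B = B' @ replicate k 1" by auto
      then have "B @ [x] = B' @ replicate (Suc k) 1"
        using True by (simp add: replicate_append_same)
      with \<open>core B'\<close> show ?thesis by blast
    next
      case False
      then have "core (B @ [x])" using snoc.prems by (simp add: core_def)
      then show ?thesis by (metis append_Nil2 replicate_0)
    qed
  qed
  then show ?thesis using that by blast
qed

text \<open>Cutting at the first zero leaves a shorter tail that is empty or has the same last
  entry, so the hypothesis on the end survives. Without a zero the whole sequence is a core.\<close>

lemma last_not_one_induct [consumes 1, case_names core step]:
  assumes "d = [] \<or> last d \<noteq> 1"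
    and core: "\<And>B. core B \<Longrightarrow> P B"
    and step: "\<And>B k d. core B \<Longrightarrow> d = [] \<or> last d \<noteq> 1 \<Longrightarrow> P d \<Longrightarrow> P (B @ replicate k 1 @ 0 # d)"
  shows "P d"
  using assms(1)
proof (induction "length d" arbitrary: d rule: less_induct)
  case less
  show ?case
  proof (cases "0 \<in> set d")
    case False
    then have "core d" using less.prems by (auto simp: core_def intro: gr0I)
    then show ?thesis by (rule core)
  next
    case True
    then obtain A d' where d: "d = A @ 0 # d'" "0 \<notin> set A"
      by (meson split_list_first)
    then obtain B k where "core B" "A = B @ replicate k 1"
      using positive_decomposition by (metis gr0I)
    moreover have "d' = [] \<or> last d' \<noteq> 1" using less.prems d by (auto split: if_splits)
    moreover have "P d'" using less.hyps[of d'] d calculation by simp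
    ultimately show ?thesis using step d by simp
  qed
qed

text \<open>Reversal turns the leftmost piece \<open>C 0 T\<close> of an image into the rightmost
  one, so evaluating the map on a reversed image requires splitting at a zero far from the left end.
  Since \<open>xs\<close> does not end in 1, the trailing ones before that zero are exactly
  \<open>replicate k 1\<close>.\<close>

lemma gate_map_append:
  assumes "xs = [] \<or> last xs \<noteq> 1"
  shows "gate_map (xs @ replicate k 1 @ 0 # ys) = gate_map xs @ 0 # replicate k 1 @ gate_map ys"
  using assms
proof (induction rule: last_not_one_induct)
  case (core B)
  then show ?case by (simp only: gate_map_first_block gate_map_core)
next
  case (step B j d)
  have "gate_map ((B @ replicate j 1 @ 0 # d) @ replicate k 1 @ 0 # ys)
      = gate_map (B @ replicate j 1 @ 0 # (d @ replicate k 1 @ 0 # ys))" by simp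
  also have "\<dots> = gate_map (B @ replicate j 1 @ 0 # d) @ 0 # replicate k 1 @ gate_map ys"
    by (simp only: gate_map_first_block[OF step.hyps(1)] step.IH) simp
  finally show ?case .
qed

section \<open>Moving a unit inside a core, and the involution by reversal\<close>

lemma core_cases:
  assumes "core B"
  obtains "B = []" | x where "B = [x]" "2 \<le> x"
  | x M y where "B = x # M @ [y]" "0 < x" "2 \<le> y" "\<forall>m\<in>set M. 0 < m"
proof (cases B)
  case Nil
  then show ?thesis using that by blast
next
  case (Cons x B')
  show ?thesis
  proof (cases B' rule: rev_cases)
    case Nil
    with Cons have "2 \<le> x" using assms by (auto simp: core_def)
    then show ?thesis using that Cons Nil by blast
  next
    case (snoc M y)
    then have "2 \<le> y" using assms Cons by (auto simp: core_def)
    then show ?thesis using that(3) snoc Cons assms by (auto simp: core_def)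
  qed
qed

lemma shift_unit_Cons_snoc: "shift_unit (x # M @ [y]) = Suc x # M @ [y - 1]"
  by (simp add: shift_unit_def)

lemma shift_unit_singleton: "shift_unit [x] = [x]"
  by (simp add: shift_unit_def)

lemma shift_unit_Nil: "shift_unit [] = []"
  by (simp add: shift_unit_def)

lemmas shift_unit_simps = shift_unit_Nil shift_unit_singleton shift_unit_Cons_snoc

text \<open>In length at least two, the ends \<open>x >= 1\<close> and \<open>y >= 2\<close> become
  \<open>x + 1 >= 2\<close> and \<open>y - 1 >= 1\<close>. After reversal the last entry is
  \<open>x + 1\<close>, so the same move carries the unit back. Shorter cores are fixed.\<close>

lemma core_rev_shift_unit:
  assumes "core B"
  shows "core (rev (shift_unit B))" and "shift_unit (rev (shift_unit B)) = rev B"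
proof -
  from assms have "core (rev (shift_unit B)) \<and> shift_unit (rev (shift_unit B)) = rev B"
  proof (cases rule: core_cases)
    case (3 x M y)
    then have "rev (shift_unit B) = (y - 1) # rev M @ [Suc x]" by (simp add: shift_unit_simps)
    with 3 show ?thesis by (auto simp: core_def shift_unit_simps)
  qed (auto simp: core_def shift_unit_simps)
  then show "core (rev (shift_unit B))" "shift_unit (rev (shift_unit B)) = rev B" by auto
qed

lemma length_shift_unit [simp]: "length (shift_unit B) = length B"
  by (simp add: shift_unit_def)

text \<open>The claims share one induction because the reversal identity applies
  \<open>gate_map_append\<close> to \<open>rev (gate_map d)\<close>, whose condition on the last
  entry is the head claim for the tail. The sum later gives preservation of cardinality, and the
  head claim the restriction on the first entry for filters.\<close>

lemma gate_map_rev_properties: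
  assumes "d = [] \<or> last d \<noteq> 1"
  shows "length (gate_map d) = length d \<and> sum_list (gate_map d) = sum_list d
    \<and> (gate_map d = [] \<or> hd (gate_map d) \<noteq> 1) \<and> gate_map (rev (gate_map d)) = rev d"
  using assms
proof (induction rule: last_not_one_induct)
  case (core B)
  then have "sum_list (shift_unit B) = sum_list B"
    and "shift_unit B = [] \<or> hd (shift_unit B) \<noteq> 1"
    by (cases rule: core_cases; simp add: shift_unit_simps)+
  with core show ?case
    using core_rev_shift_unit[OF core] by (simp add: gate_map_core)
next
  case (step B k d)
  let ?e = "gate_map d"
  from step.hyps(1) have "sum_list (shift_unit B) = sum_list B"
    and hd: "shift_unit B = [] \<or> hd (shift_unit B) \<noteq> 1"
    by (cases rule: core_cases; simp add: shift_unit_simps)+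
  moreover have "rev ?e = [] \<or> last (rev ?e) \<noteq> 1"
    using step.IH by (auto simp: last_rev)
  \<comment> \<open>By induction \<open>rev ?e\<close> is mapped to \<open>rev d\<close>, and the
    core \<open>rev (shift_unit B)\<close> is mapped back to \<open>rev B\<close>.\<close>
  from gate_map_append[OF this, of k "rev (shift_unit B)"]
  have "gate_map (rev (shift_unit B @ 0 # replicate k 1 @ ?e)) = rev (B @ replicate k 1 @ 0 # d)"
    using step.IH core_rev_shift_unit[OF step.hyps(1)] by (simp add: gate_map_core)
  ultimately show ?case
    unfolding gate_map_first_block[OF step.hyps(1)]
    using step.IH by (auto simp: hd_append)
qed

section \<open>The ideal condition on sequences and its behaviour under the map\<close>

text \<open>A full segment contains its maximum, which covers the minimum of the segment to its
  left, so the latter segment must meet the ideal. At index 0 the clause \<open>0 < i\<close>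
  forbids fullness, which is the restriction \<open>hd d <= hd \<delta>\<close>.\<close>

definition ideal_seq :: "nat list \<Rightarrow> nat list \<Rightarrow> bool" where
  "ideal_seq \<delta> d \<longleftrightarrow> length d = length \<delta> \<and>
     (\<forall>i<length \<delta>. d ! i \<le> \<delta> ! i + 1 \<and> (d ! i = \<delta> ! i + 1 \<longrightarrow> 0 < i \<and> 0 < d ! (i - 1)))"

text \<open>The first segment of \<open>y\<close> is not full, so no condition crosses the
  cut.\<close>

lemma ideal_seq_append:
  assumes "ideal_seq \<alpha> x" "ideal_seq \<beta> y"
  shows "ideal_seq (\<alpha> @ \<beta>) (x @ y)"
proof -
  have "(x @ y) ! i \<le> (\<alpha> @ \<beta>) ! i + 1 \<and>
      ((x @ y) ! i = (\<alpha> @ \<beta>) ! i + 1 \<longrightarrow> 0 < i \<and> 0 < (x @ y) ! (i - 1))"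
    if "i < length (\<alpha> @ \<beta>)" for i
  proof (cases "i < length \<alpha>")
    case True
    then show ?thesis using assms(1) by (auto simp: ideal_seq_def nth_append)
  next
    case False
    define j where "j = i - length \<alpha>"
    have "i = length \<alpha> + j" "j < length \<beta>" using False that by (auto simp: j_def)
    then show ?thesis using assms by (cases j) (auto simp: ideal_seq_def nth_append)
  qed
  then show ?thesis using assms by (simp add: ideal_seq_def)
qed

lemma ideal_seq_prefix:
  assumes "ideal_seq (\<alpha> @ \<beta>) (x @ y)" "length \<alpha> = length x"
  shows "ideal_seq \<alpha> x"
proof -
  have "x ! i \<le> \<alpha> ! i + 1 \<and> (x ! i = \<alpha> ! i + 1 \<longrightarrow> 0 < i \<and> 0 < x ! (i - 1))"
    if "i < length \<alpha>" for i
  proof -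
    have "(x @ y) ! i = x ! i" "(\<alpha> @ \<beta>) ! i = \<alpha> ! i" "(x @ y) ! (i - 1) = x ! (i - 1)"
      using that assms(2) by (auto simp: nth_append)
    moreover have "i < length (\<alpha> @ \<beta>)" using that by simp
    ultimately show ?thesis using assms(1) unfolding ideal_seq_def by metis
  qed
  then show ?thesis using assms(2) by (simp add: ideal_seq_def)
qed

text \<open>If the first entry of \<open>y\<close> were full, the entry before it, the last of
  \<open>x\<close>, would have to be positive. This is why sequences are cut right after a
  zero.\<close>

lemma ideal_seq_suffix:
  assumes "ideal_seq (\<alpha> @ \<beta>) (x @ y)" "length \<alpha> = length x" "last x = 0"
  shows "ideal_seq \<beta> y"
  unfolding ideal_seq_def
proof (intro conjI allI impI)
  show "length y = length \<beta>" using assms by (simp add: ideal_seq_def)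
next
  fix i assume i: "i < length \<beta>"
  have *: "y ! i \<le> \<beta> ! i + 1 \<and> (y ! i = \<beta> ! i + 1 \<longrightarrow> 
      0 < length x + i \<and> 0 < (x @ y) ! (length x + i - 1))"
    using assms(1,2) i unfolding ideal_seq_def
    by (auto simp: nth_append dest!: spec[of _ "length x + i"])
  then show "y ! i \<le> \<beta> ! i + 1" by blast
  have "0 < i \<and> 0 < y ! (i - 1)" if "y ! i = \<beta> ! i + 1"
    using * that assms(3) by (cases i) (auto simp: nth_append last_conv_nth split: if_splits)
  then show "y ! i = \<beta> ! i + 1 \<Longrightarrow> 0 < i" "y ! i = \<beta> ! i + 1 \<Longrightarrow> 0 < y ! (i - 1)"
    by blast+
qed

text \<open>Left neighbours become right neighbours under reversal. The right-hand side is the form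
  in which filters of the unreversed gate appear.\<close>

lemma ideal_seq_rev:
  "ideal_seq (rev \<delta>) (rev e) \<longleftrightarrow> length e = length \<delta> \<and>
     (\<forall>i<length \<delta>. e ! i \<le> \<delta> ! i + 1 \<and>
        (e ! i = \<delta> ! i + 1 \<longrightarrow> Suc i < length \<delta> \<and> 0 < e ! Suc i))"
  (is "_ \<longleftrightarrow> _ \<and> (\<forall>i<length \<delta>. ?Q i)")
proof (cases "length e = length \<delta>")
  case True
  let ?n = "length \<delta>"
  let ?P = "\<lambda>i. rev e ! i \<le> rev \<delta> ! i + 1 \<and>
    (rev e ! i = rev \<delta> ! i + 1 \<longrightarrow> 0 < i \<and> 0 < rev e ! (i - 1))"
  have PQ: "?P i \<longleftrightarrow> ?Q (?n - Suc i)" if "i < ?n" for i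
    using that True by (cases i) (auto simp: rev_nth Suc_diff_Suc)
  have "(\<forall>i<?n. ?P i) \<longleftrightarrow> (\<forall>i<?n. ?Q i)"
  proof (intro iffI allI impI)
    fix i assume "\<forall>i<?n. ?P i" "i < ?n"
    moreover from \<open>i < ?n\<close> have "?n - Suc i < ?n" "?n - Suc (?n - Suc i) = i" by auto
    ultimately show "?Q i" using PQ[of "?n - Suc i"] by metis
  next
    fix i assume "\<forall>i<?n. ?Q i" "i < ?n"
    moreover from \<open>i < ?n\<close> have "?n - Suc i < ?n" by simp
    ultimately show "?P i" using PQ[of i] by blast
  qed
  then show ?thesis using True by (simp add: ideal_seq_def)
qed (simp add: ideal_seq_def)

text \<open>All entries of the shifted core are positive, so a full segment only needs to have some
  right neighbour. The first entry was not full and can take one more unit; if that fills it, length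
  at least two provides a neighbour. The last entry, at most full before, is no longer full after
  losing a unit.\<close>

lemma ideal_seq_rev_shift_unit:
  assumes "core B" "ideal_seq \<alpha> B"
  shows "ideal_seq (rev \<alpha>) (rev (shift_unit B))"
proof -
  let ?n = "length \<alpha>"
  have len: "length B = ?n" using assms(2) by (simp add: ideal_seq_def)
  have B: "B ! i \<le> \<alpha> ! i + 1" "B ! i = \<alpha> ! i + 1 \<Longrightarrow> 0 < i" "0 < B ! i" if "i < ?n" for i
    using assms that by (auto simp: ideal_seq_def core_def)
  show ?thesis
  proof (cases "2 \<le> ?n")
    case True
    have "B \<noteq> []" using len True by auto
    then have "B ! (?n - 1) \<noteq> 1" using assms(1) len by (simp add: core_def last_conv_nth)
    with B(3)[of "?n - 1"] True have last: "2 \<le> B ! (?n - 1)" by fastforce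
    \<comment> \<open>Since \<open>?n\<close> is at least 2, the two updated positions are
      distinct.\<close>
    have sh: "shift_unit B ! i =
        (if i = 0 then B ! 0 + 1 else if i = ?n - 1 then B ! i - 1 else B ! i)" if "i < ?n" for i
      using that True len \<open>B \<noteq> []\<close>
      by (auto simp: shift_unit_def nth_list_update last_conv_nth hd_conv_nth)
    have pos: "0 < shift_unit B ! i" if "i < ?n" for i
      using that sh[OF that] last B(3)[OF that] by (auto split: if_splits)
    have "shift_unit B ! i \<le> \<alpha> ! i + 1 \<and> (shift_unit B ! i = \<alpha> ! i + 1 \<longrightarrow> Suc i < ?n)"
      if "i < ?n" for i
      using that B(1)[OF that] B(2)[OF that] True unfolding sh[OF that]
      by (cases "i = 0"; cases "i = ?n - 1"; cases "B ! i = \<alpha> ! i + 1") auto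
    then show ?thesis using pos len by (auto simp: ideal_seq_rev)
  next
    case False
    then have "shift_unit B = B" using len by (simp add: shift_unit_def)
    then show ?thesis using False B len by (fastforce simp: ideal_seq_rev)
  qed
qed

text \<open>A segment over a positive part has at least two elements, so a one never fills
  it.\<close>

lemma ideal_seq_replicate_one:
  assumes "\<forall>a\<in>set \<alpha>. 0 < a" "length \<alpha> = k"
  shows "ideal_seq \<alpha> (replicate k 1)"
  using assms nth_mem by (fastforce simp: ideal_seq_def)

lemma ideal_seq_rev_gate_map:
  assumes "d = [] \<or> last d \<noteq> 1" "ideal_seq \<delta> d" "\<forall>a\<in>set \<delta>. 0 < a"
  shows "ideal_seq (rev \<delta>) (rev (gate_map d))"
  using assms
proof (induction arbitrary: \<delta> rule: last_not_one_induct)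
  case (core B)
  then show ?case by (simp add: gate_map_core ideal_seq_rev_shift_unit)
next
  case (step B k d)
  let ?m = "length B"
  \<comment> \<open>The composition is cut to match \<open>d\<close>: \<open>\<alpha>\<close> under
    the core, \<open>\<beta>\<close> under the ones and their zero, \<open>\<gamma>\<close> under
    the tail.\<close>
  define \<alpha> \<beta> \<gamma> where "\<alpha> = take ?m \<delta>" and "\<beta> = take (Suc k) (drop ?m \<delta>)"
    and "\<gamma> = drop (Suc k) (drop ?m \<delta>)"
  have \<delta>: "\<delta> = \<alpha> @ \<beta> @ \<gamma>" unfolding \<alpha>_def \<beta>_def \<gamma>_def by (simp only: append_take_drop_id)
  have "length \<delta> = ?m + Suc k + length d" using step.prems by (simp add: ideal_seq_def)
  then have len: "length \<alpha> = ?m" "length \<beta> = Suc k" by (auto simp: \<alpha>_def \<beta>_def)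
  \<comment> \<open>After the exchange the zero stands over \<open>b\<close>, the first part of
    \<open>\<beta>\<close>, and the ones stand over \<open>\<beta>'\<close>.\<close>
  then obtain b \<beta>' where \<beta>: "\<beta> = b # \<beta>'" "length \<beta>' = k" by (cases \<beta>) auto
  have "ideal_seq \<alpha> B"
    using step.prems(1) len by (auto simp: \<delta> intro: ideal_seq_prefix)
  then have "ideal_seq (rev \<alpha>) (rev (shift_unit B))"
    using step.hyps(1) by (rule ideal_seq_rev_shift_unit[rotated])
  moreover have "ideal_seq [b] [0]" by (simp add: ideal_seq_def)
  moreover have "ideal_seq (rev \<beta>') (replicate k 1)"
    using step.prems(2) by (intro ideal_seq_replicate_one) (auto simp: \<delta> \<beta>)
  moreover have "ideal_seq \<gamma> d"
    using step.prems(1) len ideal_seq_suffix[of "\<alpha> @ \<beta>" \<gamma> "B @ replicate k 1 @ [0]" d]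
    by (simp add: \<delta>)
  then have "ideal_seq (rev \<gamma>) (rev (gate_map d))"
    using step.IH step.prems(2) by (simp add: \<delta>)
  ultimately have "ideal_seq (rev \<gamma> @ rev \<beta>' @ [b] @ rev \<alpha>)
      (rev (gate_map d) @ replicate k 1 @ [0] @ rev (shift_unit B))"
    by (intro ideal_seq_append)
  then show ?case
    unfolding gate_map_first_block[OF step.hyps(1)] \<delta> \<beta> by simp
qed

section \<open>Ideals and filters of the gate in terms of sequences\<close>

lemma gate_mem [simp]: "(i, j) \<in> gate \<delta> \<longleftrightarrow> i < length \<delta> \<and> j \<le> \<delta> ! i"
  by (auto simp: gate_def gate_chain_def)

text \<open>Taking smallest elements already respects the covers inside a segment, so only the
  covers joining neighbouring segments give conditions. Closure under covers then extends along
  chains of covers to the whole order.\<close>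

lemma gate_ideal_lower_set:
  assumes "d \<in> gate_seqs \<delta>"
  shows "gate_ideal \<delta> (lower_set \<delta> d) \<longleftrightarrow>
    (\<forall>i. Suc i < length \<delta> \<longrightarrow> d ! Suc i = \<delta> ! Suc i + 1 \<longrightarrow> 0 < d ! i)" (is "_ \<longleftrightarrow> ?R")
proof
  assume I: "gate_ideal \<delta> (lower_set \<delta> d)"
  show ?R
  proof (intro allI impI)
    fix i assume i: "Suc i < length \<delta>" "d ! Suc i = \<delta> ! Suc i + 1"
    then have "((i, 0), (Suc i, \<delta> ! Suc i)) \<in> gate_order \<delta>"
      by (auto simp: gate_order_def gate_covers_def)
    moreover have "(Suc i, \<delta> ! Suc i) \<in> lower_set \<delta> d" using i by (simp add: lower_set_def)
    ultimately have "(i, 0) \<in> lower_set \<delta> d" using I unfolding gate_ideal_def by blast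
    then show "0 < d ! i" by (simp add: lower_set_def)
  qed
next
  assume R: ?R
  have step: "x \<in> lower_set \<delta> d" if "(x, y) \<in> gate_covers \<delta>" "y \<in> lower_set \<delta> d" for x y
    using that assms R by (fastforce simp: gate_covers_def lower_set_def gate_seqs_def)
  have "x \<in> lower_set \<delta> d" if "(x, y) \<in> (gate_covers \<delta>)\<^sup>*" "y \<in> lower_set \<delta> d" for x y
    using that by (induction rule: converse_rtrancl_induct) (auto intro: step)
  then show "gate_ideal \<delta> (lower_set \<delta> d)"
    by (auto simp: gate_ideal_def gate_order_def lower_set_def)
qed

lemma gate_filter_upper_set:
  assumes "e \<in> gate_seqs \<delta>"
  shows "gate_filter \<delta> (upper_set \<delta> e) \<longleftrightarrow>
    (\<forall>i. Suc i < length \<delta> \<longrightarrow> e ! i = \<delta> ! i + 1 \<longrightarrow> 0 < e ! Suc i)" (is "_ \<longleftrightarrow> ?R")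
proof
  assume U: "gate_filter \<delta> (upper_set \<delta> e)"
  show ?R
  proof (intro allI impI)
    fix i assume i: "Suc i < length \<delta>" "e ! i = \<delta> ! i + 1"
    then have "((i, 0), (Suc i, \<delta> ! Suc i)) \<in> gate_order \<delta>"
      by (auto simp: gate_order_def gate_covers_def)
    moreover have "(i, 0) \<in> upper_set \<delta> e" using i by (simp add: upper_set_def)
    ultimately have "(Suc i, \<delta> ! Suc i) \<in> upper_set \<delta> e" using U unfolding gate_filter_def by blast
    then show "0 < e ! Suc i" by (simp add: upper_set_def)
  qed
next
  assume R: ?R
  have step: "y \<in> upper_set \<delta> e" if "(x, y) \<in> gate_covers \<delta>" "x \<in> upper_set \<delta> e" for x y
    using that assms R by (fastforce simp: gate_covers_def upper_set_def gate_seqs_def)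
  have "y \<in> upper_set \<delta> e" if "(x, y) \<in> (gate_covers \<delta>)\<^sup>*" "x \<in> upper_set \<delta> e" for x y
    using that by (induction rule: rtrancl_induct) (auto intro: step)
  then show "gate_filter \<delta> (upper_set \<delta> e)"
    by (auto simp: gate_filter_def gate_order_def upper_set_def)
qed

text \<open>The fibre over \<open>i\<close> has \<open>d ! i\<close> elements, which serves both to
  count the set and to recover \<open>d\<close> from it.\<close>

lemma lower_set_Sigma:
  assumes "d \<in> gate_seqs \<delta>"
  shows "lower_set \<delta> d = (SIGMA i:{..<length \<delta>}. {..<d ! i})"
  using assms by (fastforce simp: lower_set_def gate_seqs_def)

lemma upper_set_Sigma:
  assumes "e \<in> gate_seqs \<delta>"
  shows "upper_set \<delta> e = (SIGMA i:{..<length \<delta>}. {Suc (\<delta> ! i) - e ! i..\<delta> ! i})"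
  using assms by (fastforce simp: upper_set_def gate_seqs_def)

lemma card_lower_set: "d \<in> gate_seqs \<delta> \<Longrightarrow> card (lower_set \<delta> d) = sum_list d"
  by (simp add: lower_set_Sigma sum_list_sum_nth atLeast0LessThan)
    (simp add: gate_seqs_def)

lemma card_upper_set:
  assumes "e \<in> gate_seqs \<delta>"
  shows "card (upper_set \<delta> e) = sum_list e"
proof -
  have "card (upper_set \<delta> e) = (\<Sum>i<length \<delta>. Suc (\<delta> ! i) - (Suc (\<delta> ! i) - e ! i))"
    by (simp add: upper_set_Sigma[OF assms])
  \<comment> \<open>The bound \<open>e ! i <= \<delta> ! i + 1\<close> keeps the truncated
    subtractions exact.\<close>
  also have "\<dots> = (\<Sum>i<length \<delta>. e ! i)"
    using assms by (intro sum.cong) (auto simp: gate_seqs_def)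
  also have "\<dots> = sum_list e"
    using assms by (simp add: sum_list_sum_nth atLeast0LessThan gate_seqs_def)
  finally show ?thesis .
qed

lemma inj_on_lower_set: "inj_on (lower_set \<delta>) (gate_seqs \<delta>)"
proof
  fix d d' assume d: "d \<in> gate_seqs \<delta>" "d' \<in> gate_seqs \<delta>" "lower_set \<delta> d = lower_set \<delta> d'"
  show "d = d'"
  proof (rule nth_equalityI)
    show "length d = length d'" using d by (simp add: gate_seqs_def)
    fix i assume "i < length d"
    then have i: "i < length \<delta>" using d by (simp add: gate_seqs_def)
    have "Sigma {..<length \<delta>} (\<lambda>i. {..<d ! i}) `` {i} = Sigma {..<length \<delta>} (\<lambda>i. {..<d' ! i}) `` {i}"
      using d by (simp add: lower_set_Sigma)
    then show "d ! i = d' ! i" using i by (simp add: Sigma_Image)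
  qed
qed

lemma inj_on_upper_set: "inj_on (upper_set \<delta>) (gate_seqs \<delta>)"
proof
  fix e e' assume e: "e \<in> gate_seqs \<delta>" "e' \<in> gate_seqs \<delta>" "upper_set \<delta> e = upper_set \<delta> e'"
  show "e = e'"
  proof (rule nth_equalityI)
    show "length e = length e'" using e by (simp add: gate_seqs_def)
    fix i assume "i < length e"
    then have i: "i < length \<delta>" using e by (simp add: gate_seqs_def)
    have "Sigma {..<length \<delta>} (\<lambda>i. {Suc (\<delta> ! i) - e ! i..\<delta> ! i}) `` {i}
        = Sigma {..<length \<delta>} (\<lambda>i. {Suc (\<delta> ! i) - e' ! i..\<delta> ! i}) `` {i}"
      using e by (simp add: upper_set_Sigma)
    then have "{Suc (\<delta> ! i) - e ! i..\<delta> ! i} = {Suc (\<delta> ! i) - e' ! i..\<delta> ! i}"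
      using i by (simp only: Sigma_Image) simp
    moreover have "e ! i \<le> \<delta> ! i + 1" "e' ! i \<le> \<delta> ! i + 1"
      using e i by (auto simp: gate_seqs_def)
    ultimately show "e ! i = e' ! i" by auto
  qed
qed

definition restricted_seqs :: "nat list \<Rightarrow> nat list set" where
  "restricted_seqs \<delta> = {d. ideal_seq \<delta> d \<and> last d \<noteq> 1}"

lemma restricted_seqs_subset: "restricted_seqs \<delta> \<subseteq> gate_seqs \<delta>"
  by (auto simp: restricted_seqs_def gate_seqs_def ideal_seq_def)

lemma rev_in_gate_seqs: "rev e \<in> gate_seqs (rev \<delta>) \<Longrightarrow> e \<in> gate_seqs \<delta>"
proof -
  assume *: "rev e \<in> gate_seqs (rev \<delta>)"
  have "e ! i \<le> \<delta> ! i + 1" if "i < length \<delta>" for i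
    using * that by (auto simp: gate_seqs_def rev_nth dest!: spec[of _ "length \<delta> - Suc i"])
  with * show ?thesis by (simp add: gate_seqs_def)
qed

text \<open>The instance of \<open>ideal_seq\<close> at index 0 is the restriction on the first
  entry; the other instances are the covers between segments.\<close>

lemma restricted_ideals_eq:
  assumes "\<delta> \<noteq> []"
  shows "restricted_ideals \<delta> = lower_set \<delta> ` restricted_seqs \<delta>"
proof -
  have "gate_ideal \<delta> (lower_set \<delta> d) \<and> hd d \<le> hd \<delta> \<longleftrightarrow> ideal_seq \<delta> d" if d: "d \<in> gate_seqs \<delta>" for d
  proof -
    have "d \<noteq> []" using d assms by (auto simp: gate_seqs_def)
    have "(\<forall>i<length \<delta>. d ! i = \<delta> ! i + 1 \<longrightarrow> 0 < i \<and> 0 < d ! (i - 1)) \<longleftrightarrow>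
      d ! 0 \<noteq> \<delta> ! 0 + 1 \<and> (\<forall>i. Suc i < length \<delta> \<longrightarrow> d ! Suc i = \<delta> ! Suc i + 1 \<longrightarrow> 0 < d ! i)"
      (is "?L \<longleftrightarrow> ?R")
    proof
      assume ?L
      then show ?R using assms by fastforce
    next
      assume R: ?R
      have "0 < i \<and> 0 < d ! (i - 1)" if "i < length \<delta>" "d ! i = \<delta> ! i + 1" for i
        using R that by (cases i) auto
      then show ?L by blast
    qed
    moreover have "d ! 0 \<le> \<delta> ! 0 + 1" using d assms by (simp add: gate_seqs_def)
    ultimately show ?thesis
      using d \<open>d \<noteq> []\<close> assms unfolding gate_ideal_lower_set[OF d]
      by (auto simp: ideal_seq_def gate_seqs_def hd_conv_nth)
  qed
  moreover have "ideal_seq \<delta> d \<Longrightarrow> d \<in> gate_seqs \<delta>" for d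
    by (simp add: ideal_seq_def gate_seqs_def)
  ultimately show ?thesis
    unfolding restricted_ideals_def restricted_seqs_def by blast
qed

text \<open>The gate of \<open>rev \<delta>\<close> is the order dual of the gate of
  \<open>\<delta>\<close> with its segments read from right to left. Hence a filter given by
  \<open>e\<close> corresponds to an ideal given by \<open>rev e\<close>, and the restrictions on
  first and last entries trade places.\<close>

lemma restricted_filters_eq:
  assumes "\<delta> \<noteq> []"
  shows "restricted_filters \<delta> = upper_set \<delta> ` rev ` restricted_seqs (rev \<delta>)"
proof -
  have "gate_filter \<delta> (upper_set \<delta> e) \<and> last e \<le> last \<delta> \<longleftrightarrow> ideal_seq (rev \<delta>) (rev e)"
    if e: "e \<in> gate_seqs \<delta>" for e
  proof -
    let ?n = "length \<delta>"
    have "e \<noteq> []" using e assms by (auto simp: gate_seqs_def)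
    have "(\<forall>i<?n. e ! i = \<delta> ! i + 1 \<longrightarrow> Suc i < ?n \<and> 0 < e ! Suc i) \<longleftrightarrow>
      e ! (?n - 1) \<noteq> \<delta> ! (?n - 1) + 1 \<and>
        (\<forall>i. Suc i < ?n \<longrightarrow> e ! i = \<delta> ! i + 1 \<longrightarrow> 0 < e ! Suc i)"
      (is "?L \<longleftrightarrow> ?R")
    proof
      assume L: ?L
      then have "e ! (?n - 1) \<noteq> \<delta> ! (?n - 1) + 1" using assms by (auto dest: spec[of _ "?n - 1"])
      with L show ?R by auto
    next
      assume R: ?R
      have "Suc i < ?n \<and> 0 < e ! Suc i" if "i < ?n" "e ! i = \<delta> ! i + 1" for i
        using R that by (cases "i = ?n - 1") auto
      then show ?L by blast
    qed
    moreover have "e ! (?n - 1) \<le> \<delta> ! (?n - 1) + 1" using e assms by (simp add: gate_seqs_def)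
    then have "e ! (?n - 1) \<noteq> \<delta> ! (?n - 1) + 1 \<longleftrightarrow> e ! (?n - 1) \<le> \<delta> ! (?n - 1)" by auto
    ultimately show ?thesis
      using e \<open>e \<noteq> []\<close> assms unfolding gate_filter_upper_set[OF e] ideal_seq_rev
      by (auto simp: gate_seqs_def last_conv_nth)
  qed
  moreover have "e \<in> gate_seqs \<delta>" if "ideal_seq (rev \<delta>) (rev e)" for e
    using that unfolding ideal_seq_rev by (simp add: gate_seqs_def)
  moreover have "last (rev e) = hd e" if "e \<in> gate_seqs \<delta>" for e
    using that assms by (auto simp: gate_seqs_def last_rev)
  ultimately have "e \<in> gate_seqs \<delta> \<and> gate_filter \<delta> (upper_set \<delta> e) \<and> hd e \<noteq> 1 \<and> last e \<le> last \<delta>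
      \<longleftrightarrow> rev e \<in> restricted_seqs (rev \<delta>)" for e
    unfolding restricted_seqs_def mem_Collect_eq by metis
  then have "restricted_filters \<delta> = upper_set \<delta> ` {e. rev e \<in> restricted_seqs (rev \<delta>)}"
    unfolding restricted_filters_def by blast
  also have "{e. rev e \<in> restricted_seqs (rev \<delta>)} = rev ` restricted_seqs (rev \<delta>)"
    by (auto simp: image_iff) (metis rev_rev_ident)
  finally show ?thesis .
qed

section \<open>The bijection on sequences and its transfer to ideals and filters\<close>

lemma rev_gate_map_restricted:
  assumes "composition \<delta>" "d \<in> restricted_seqs \<delta>"
  shows "rev (gate_map d) \<in> restricted_seqs (rev \<delta>)"
proof -
  have "d \<noteq> []" "last d \<noteq> 1" "ideal_seq \<delta> d" "\<forall>a\<in>set \<delta>. 0 < a"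
    using assms by (auto simp: restricted_seqs_def ideal_seq_def composition_def)
  then show ?thesis
    using gate_map_rev_properties[of d] ideal_seq_rev_gate_map[of d \<delta>]
    by (auto simp: restricted_seqs_def last_rev)
qed

lemma bij_betw_gate_map:
  assumes "composition \<delta>"
  shows "bij_betw gate_map (restricted_seqs \<delta>) (rev ` restricted_seqs (rev \<delta>))"
\<comment> \<open>As the map followed by reversal is an involution, its inverse is its conjugate by
  reversal. The two inclusions are then one lemma, used for \<open>\<delta>\<close> and for
  \<open>rev \<delta>\<close>.\<close>
proof (rule bij_betw_byWitness[where f' = "\<lambda>e. rev (gate_map (rev e))"])
  have rev_\<delta>: "composition (rev \<delta>)" using assms by (simp add: composition_def)
  have inv: "gate_map (rev (gate_map d)) = rev d" if "last d \<noteq> 1" for d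
    using gate_map_rev_properties that by blast
  show "\<forall>d\<in>restricted_seqs \<delta>. rev (gate_map (rev (gate_map d))) = d"
    by (simp add: inv restricted_seqs_def)
  show "\<forall>e\<in>rev ` restricted_seqs (rev \<delta>). gate_map (rev (gate_map (rev e))) = e"
    by (auto simp: inv restricted_seqs_def)
  show "gate_map ` restricted_seqs \<delta> \<subseteq> rev ` restricted_seqs (rev \<delta>)"
    using rev_gate_map_restricted[OF assms] by (metis image_eqI image_subsetI rev_rev_ident)
  show "(\<lambda>e. rev (gate_map (rev e))) ` rev ` restricted_seqs (rev \<delta>) \<subseteq> restricted_seqs \<delta>"
    using rev_gate_map_restricted[OF rev_\<delta>] by auto
qed

text \<open>A block with trailing ones ends in 1, so it cannot end \<open>d\<close>; maximality of
  the block then forces a zero after it.\<close>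

lemma trailing_ones_followed_by_zeroI:
  assumes "last d \<noteq> 1"
  shows "trailing_ones_followed_by_zero d"
  unfolding trailing_ones_followed_by_zero_def
proof (intro allI impI, elim conjE)
  fix U B V assume *: "d = U @ B @ V" "is_block U B V" "trailing_ones B \<noteq> []"
  then have "last B = 1" "B \<noteq> []"
    by (cases B rule: rev_cases; auto simp: trailing_ones_def split: if_splits)+
  then have "V \<noteq> []" using * assms by auto
  then show "V \<noteq> [] \<and> hd V = 0" using * by (simp add: is_block_def)
qed

theorem theorem2p1:
  fixes \<delta> :: "nat list"
  assumes "composition \<delta>"
  shows "(\<forall>I\<in>restricted_ideals \<delta>. \<exists>!d. d \<in> gate_seqs \<delta> \<and> I = lower_set \<delta> d)
    \<and> (\<forall>d\<in>gate_seqs \<delta>. lower_set \<delta> d \<in> restricted_ideals \<delta> \<longrightarrow>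
         trailing_ones_followed_by_zero d \<and> gate_map d \<in> gate_seqs \<delta> \<and>
         gate_phi \<delta> (lower_set \<delta> d) = upper_set \<delta> (gate_map d))
    \<and> bij_betw (gate_phi \<delta>) (restricted_ideals \<delta>) (restricted_filters \<delta>)
    \<and> (\<forall>I\<in>restricted_ideals \<delta>. card (gate_phi \<delta> I) = card I)"
proof -
  let ?R = "restricted_seqs \<delta>" and ?F = "rev ` restricted_seqs (rev \<delta>)"
  have "\<delta> \<noteq> []" using assms by (simp add: composition_def)
  note ideals = restricted_ideals_eq[OF this] and filters = restricted_filters_eq[OF this]
  have R: "d \<in> gate_seqs \<delta>" "last d \<noteq> 1" if "d \<in> ?R" for d
    using that restricted_seqs_subset by (auto simp: restricted_seqs_def)
  have F: "?F \<subseteq> gate_seqs \<delta>"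
    using restricted_seqs_subset rev_in_gate_seqs by fastforce
  have seq_unique: "d = d'" if "d \<in> gate_seqs \<delta>" "d' \<in> gate_seqs \<delta>" "lower_set \<delta> d = lower_set \<delta> d'"
    for d d'
    using that by (metis inj_on_lower_set inj_onD)
  \<comment> \<open>A restricted ideal comes from some restricted sequence, which injectivity
    identifies with the given \<open>d\<close>.\<close>
  have restricted: "d \<in> ?R" if "d \<in> gate_seqs \<delta>" "lower_set \<delta> d \<in> restricted_ideals \<delta>" for d
    using that seq_unique R(1) unfolding ideals by blast
  have phi: "gate_phi \<delta> (lower_set \<delta> d) = upper_set \<delta> (gate_map d)" if "d \<in> gate_seqs \<delta>" for d
  proof -
    have "(THE d'. d' \<in> gate_seqs \<delta> \<and> lower_set \<delta> d = lower_set \<delta> d') = d"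
      using that seq_unique by (intro the_equality) auto
    then show ?thesis by (simp add: gate_phi_def)
  qed
  note bij = bij_betw_gate_map[OF assms]
  have map: "gate_map d \<in> gate_seqs \<delta>" if "d \<in> ?R" for d
    using bij_betwE[OF bij] that F by blast
  have "bij_betw (lower_set \<delta>) ?R (restricted_ideals \<delta>)"
    unfolding ideals by (rule inj_on_imp_bij_betw) (meson inj_on_lower_set inj_on_subset restricted_seqs_subset)
  moreover have "bij_betw (upper_set \<delta>) ?F (restricted_filters \<delta>)"
    unfolding filters by (rule inj_on_imp_bij_betw) (meson inj_on_upper_set inj_on_subset F)
  with bij have "bij_betw (upper_set \<delta> \<circ> gate_map) ?R (restricted_filters \<delta>)"
    by (rule bij_betw_trans)
  then have "bij_betw (gate_phi \<delta> \<circ> lower_set \<delta>) ?R (restricted_filters \<delta>)"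
    by (rule bij_betw_cong[THEN iffD1, rotated]) (simp add: phi R)
  \<comment> \<open>The bijection \<open>lower_set \<delta>\<close> is cancelled on the right of the
    composite.\<close>
  ultimately have "bij_betw (gate_phi \<delta>) (restricted_ideals \<delta>) (restricted_filters \<delta>)"
    using bij_betw_comp_iff by blast
  moreover have "card (gate_phi \<delta> (lower_set \<delta> d)) = card (lower_set \<delta> d)" if "d \<in> ?R" for d
    using that R map[OF that] gate_map_rev_properties[of d]
    by (simp add: phi card_upper_set card_lower_set)
  moreover have "\<forall>I\<in>restricted_ideals \<delta>. \<exists>!d. d \<in> gate_seqs \<delta> \<and> I = lower_set \<delta> d"
    using R(1) seq_unique unfolding ideals by blast
  ultimately show ?thesis
    using restricted phi map R(2) trailing_ones_followed_by_zeroI unfolding ideals by auto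
qed

end
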